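(* Let $\mu$ be a positive measure on $\mathbb{R}^d$ such that $0<\int p(x)^2\,d\mu(x)<\infty$ for every non-zero polynomial $p$ in $d$ variables. Let $\{\mathbf{p}_n\}_{n\in\mathbb{N}_0}$ be an orthonormal basis of polynomials with respect to $\mu$ (grouped by degree into vectors $\mathbf{p}_n$ of size $r_n$), with associated recurrence matrices $A_{n,i}$ and $B_{n,i}$, $i\in[d]$, $n\in\mathbb{N}$, and suppose that $\{\mathbf{p}_n\}_{n\in\mathbb{N}_0}$ is a canonical basis, so that for every $n\in\mathbb{N}$ one has $\sum_{i\in[d]}B_{n,i}^TB_{n,i}=\Lambda_n$ with $\Lambda_n$ diagonal with diagonal elements in non-decreasing order. Then, for each $n\ge 0$ and all $x\in\mathbb{R}^d$, $$\Lambda_{n+1}\mathbf{p}_{n+1}(x)=\Big(\sum_{i\in[d]}x_iB_{n+1,i}^T\Big)\mathbf{p}_n(x)-\Big(\sum_{i\in[d]}B_{n+1,i}^TA_{n+1,i}\Big)\mathbf{p}_n(x)-\Big(\sum_{i\in[d]}B_{n+1,i}^TB_{n,i}^T\Big)\mathbf{p}_{n-1}(x),$$ where $\Lambda_{n+1}\in\mathbb{R}^{r_{n+1}\times r_{n+1}}$ is diagonal and positive-definite (and hence invertible).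
   Context: Notation: $d\in\mathbb{N}$, $[d]=\{1,\dots,d\}$, $\mathbb{N}_0=\mathbb{N}\cup\{0\}$. $\Pi_n^d$ is the space of real polynomials in $d$ variables of total degree at most $n$, and $r_n=\binom{n+d-1}{n}$ is the dimension of the span of the monomials of degree exactly $n$ (with $r_{-1}=0$). The inner product is $\langle f,g\rangle=\int f g\,d\mu$. Orthonormal basis: let $\mathcal{V}_n^d=\{p\in\Pi_n^d:\langle p,q\rangle=0\ \ \forall q\in\Pi_{n-1}^d\}$, which has dimension $r_n$ (with $\mathcal{V}_0^d$ the constants). For each $n\in\mathbb{N}_0$, $\mathbf{p}_n=(p_{(n,1)},\dots,p_{(n,r_n)})^T$ is a vector whose entries form an orthonormal basis of $\mathcal{V}_n^d$. By convention $\mathbf{p}_{-1}=0$, and the term involving $\mathbf{p}_{-1}$ is zero (so no matrix $B_{0,i}$ needs to be specified). Recurrence matrices: there exist unique matrices $A_{n+1,i}\in\mathbb{R}^{r_n\times r_n}$ and $B_{n+1,i}\in\mathbb{R}^{r_n\times r_{n+1}}$ ($n\ge0$, $i\in[d]$) such that $$x_i\mathbf{p}_n(x)=B_{n+1,i}\mathbf{p}_{n+1}(x)+A_{n+1,i}\mathbf{p}_n(x)+B_{n,i}^T\mathbf{p}_{n-1}(x),\qquad i\in[d],\ n\ge0.$$ These are called the recurrence matrices of $\{\mathbf{p}_n\}$. It is known that they satisfy $\operatorname{rank}(B_{n,i})=r_{n-1}$ and $\operatorname{rank}(B_n)=r_n$ for $n\in\mathbb{N}$, where $B_n=(B_{n,1}^T,\dots,B_{n,d}^T)^T\in\mathbb{R}^{dr_{n-1}\times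 r_n}$ is the vertical stacking. Canonical basis: $\{\mathbf{p}_n\}_{n\in\mathbb{N}_0}$ is a canonical (orthonormal) basis if for every $n\in\mathbb{N}$, $B_n^TB_n=\sum_{i\in[d]}B_{n,i}^TB_{n,i}=\Lambda_n$, where each $\Lambda_n$ is a diagonal matrix with its diagonal elements appearing in non-decreasing order. *)

theory Defs
  imports "HOL-Analysis.Analysis" "Jordan_Normal_Form.Matrix"
begin

text \<open>
  Euclidean space is \<open>real^'d\<close>, where the finite index type \<open>'d\<close> plays the role of
  \<open>[d]\<close>.  Objects whose size depends on the degree \<open>n\<close> (the vectors \<open>p\<^sub>n(x)\<close> and the
  recurrence matrices) are vectors and matrices of the theory \<open>Jordan_Normal_Form.Matrix\<close>, which
  carry their dimension and are indexed from 0.  The symbols \<open>$\<close> and \<open>\<bullet>\<close> are left to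
  \<open>real^'d\<close>.
\<close>

no_notation Matrix.vec_index (infixl \<open>$\<close> 100)
no_notation Matrix.scalar_prod (infix \<open>\<bullet>\<close> 70)
notation Matrix.vec_index (infixl \<open>$v\<close> 100)
notation Matrix.scalar_prod (infix \<open>\<bullet>v\<close> 70)

definition monomial_fun :: "('d \<Rightarrow> nat) \<Rightarrow> real^'d \<Rightarrow> real" where
  "monomial_fun \<alpha> x = (\<Prod>i\<in>UNIV. (x $ i) ^ \<alpha> i)"

text \<open>
  Polynomials are identified with the functions they induce on \<open>real^'d\<close>, which loses nothing
  because the field of real numbers is infinite; the zero polynomial is the zero function.
\<close>

definition polys_upto :: "nat \<Rightarrow> (real^'d \<Rightarrow> real) set" where
  "polys_upto n =
     {p. \<exists>c :: ('d \<Rightarrow> nat) \<Rightarrow> real.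
        p = (\<lambda>x. \<Sum>\<alpha> | (\<Sum>i\<in>UNIV. \<alpha> i) \<le> n. c \<alpha> * monomial_fun \<alpha> x)}"

definition polys :: "(real^'d \<Rightarrow> real) set" where
  "polys = (\<Union>n. polys_upto n)"

definition hom_dim :: "'d::finite itself \<Rightarrow> nat \<Rightarrow> nat" where
  "hom_dim _ n = (n + CARD('d) - 1) choose n"

definition admissible_measure :: "(real^'d) measure \<Rightarrow> bool" where
  "admissible_measure M \<longleftrightarrow> sets M = sets borel \<and>
     (\<forall>p\<in>polys. p \<noteq> (\<lambda>x. 0) \<longrightarrow>
        0 < (\<integral>\<^sup>+x. ennreal ((p x)\<^sup>2) \<partial>M) \<and> (\<integral>\<^sup>+x. ennreal ((p x)\<^sup>2) \<partial>M) < \<infinity>)"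

definition ip :: "(real^'d) measure \<Rightarrow> (real^'d \<Rightarrow> real) \<Rightarrow> (real^'d \<Rightarrow> real) \<Rightarrow> real" where
  "ip M f g = (\<integral>x. f x * g x \<partial>M)"

text \<open>For \<open>n = 0\<close> there is no orthogonality condition, as \<open>\<Pi>\<close> in degree \<open>-1\<close> is zero.\<close>

definition orth_polys :: "(real^'d) measure \<Rightarrow> nat \<Rightarrow> (real^'d \<Rightarrow> real) set" where
  "orth_polys M n =
     {p \<in> polys_upto n. n > 0 \<longrightarrow> (\<forall>q\<in>polys_upto (n - 1). ip M p q = 0)}"

text \<open>
  The entries of \<open>p n\<close> are the functions \<open>\<lambda>x. p n x $v k\<close> for \<open>k < r\<^sub>n\<close>.  They form an
  orthonormal basis: linear independence follows from orthonormality, so only spanning is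
  required in addition.
\<close>

definition orthonormal_poly_basis ::
  "(real^'d) measure \<Rightarrow> (nat \<Rightarrow> real^'d \<Rightarrow> real Matrix.vec) \<Rightarrow> bool" where
  "orthonormal_poly_basis M p \<longleftrightarrow>
     (\<forall>n. let r = hom_dim TYPE('d) n in
        (\<forall>x. p n x \<in> carrier_vec r) \<and>
        (\<forall>k<r. (\<lambda>x. p n x $v k) \<in> orth_polys M n) \<and>
        (\<forall>j<r. \<forall>k<r. ip M (\<lambda>x. p n x $v j) (\<lambda>x. p n x $v k) = (if j = k then 1 else 0)) \<and>
        (\<forall>q\<in>orth_polys M n. \<exists>c :: nat \<Rightarrow> real. q = (\<lambda>x. \<Sum>k<r. c k * p n x $v k)))"

definition recurrence_matrices ::
  "(nat \<Rightarrow> real^'d \<Rightarrow> real Matrix.vec) \<Rightarrow> (nat \<Rightarrow> 'd \<Rightarrow> real Matrix.mat) \<Rightarrow>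
   (nat \<Rightarrow> 'd \<Rightarrow> real Matrix.mat) \<Rightarrow> bool" where
  "recurrence_matrices p A B \<longleftrightarrow>
     (\<forall>n i. let r = hom_dim TYPE('d) in
        A (Suc n) i \<in> carrier_mat (r n) (r n) \<and>
        B (Suc n) i \<in> carrier_mat (r n) (r (Suc n)) \<and>
        (\<forall>x. (x $ i) \<cdot>\<^sub>v p n x =
           B (Suc n) i *\<^sub>v p (Suc n) x + A (Suc n) i *\<^sub>v p n x +
           (if n = 0 then 0\<^sub>v (r n) else transpose_mat (B n i) *\<^sub>v p (n - 1) x)))"

text \<open>Matrices of different sizes share one type, so a finite sum needs its size as an argument.\<close>

definition mat_sum ::
  "nat \<Rightarrow> nat \<Rightarrow> ('d::finite \<Rightarrow> real Matrix.mat) \<Rightarrow> real Matrix.mat" where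
  "mat_sum nr nc F = Matrix.mat nr nc (\<lambda>(j, k). \<Sum>i\<in>UNIV. F i $$ (j, k))"

text \<open>
  The defining property of a canonical basis, in terms of its recurrence matrices \<open>B\<close>:
  \<open>\<Lambda> n\<close> is the Gram matrix of the stacked matrix \<open>B\<^sub>n\<close>.
\<close>

definition canonical_recurrence ::
  "(nat \<Rightarrow> 'd::finite \<Rightarrow> real Matrix.mat) \<Rightarrow> (nat \<Rightarrow> real Matrix.mat) \<Rightarrow> bool" where
  "canonical_recurrence B \<Lambda> \<longleftrightarrow>
     (\<forall>n\<ge>1. let r = hom_dim TYPE('d) n in
        mat_sum r r (\<lambda>i. transpose_mat (B n i) * B n i) = \<Lambda> n \<and>
        diagonal_mat (\<Lambda> n) \<and>
        (\<forall>j k. j \<le> k \<and> k < r \<longrightarrow> \<Lambda> n $$ (j, j) \<le> \<Lambda> n $$ (k, k)))"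

definition pos_def_mat :: "nat \<Rightarrow> real Matrix.mat \<Rightarrow> bool" where
  "pos_def_mat n A \<longleftrightarrow> A \<in> carrier_mat n n \<and> transpose_mat A = A \<and>
     (\<forall>v\<in>carrier_vec n. v \<noteq> 0\<^sub>v n \<longrightarrow> v \<bullet>v (A *\<^sub>v v) > 0)"

end

theory Submission
  imports Defs
begin

text \<open>
  Multiplying the three-term recurrence for coordinate \<open>i\<close> from the left by \<open>B\<^sub>i\<^sup>T\<close> and summing over
  \<open>i\<close> turns the coefficient of the leading vector into \<open>\<Sum>\<^sub>i B\<^sub>i\<^sup>T B\<^sub>i = \<Lambda>\<close>, which gives the identity.

  What needs an argument is that \<open>\<Lambda>\<close> is positive definite.  Its quadratic form at \<open>v\<close> is
  \<open>\<Sum>\<^sub>i |B\<^sub>i v|\<^sup>2\<close> (\<open>quadratic_form_gram_sum\<close>), so the stacked matrix must have trivial kernel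
  (\<open>stacked_recurrence_kernel_trivial\<close>).  This is the place where the measure enters.  The entries of
  \<open>B\<^sub>i\<close> are the inner products of \<open>x\<^sub>i p\<^sub>n\<close> with \<open>p\<^sub>n\<^sub>+\<^sub>1\<close>
  (\<open>recurrence_inner_product\<close>).  Hence \<open>B\<^sub>i v = 0\<close> for all \<open>i\<close> says that the
  polynomial \<open>f\<close> with coordinates \<open>v\<close> in the basis \<open>p\<^sub>n\<^sub>+\<^sub>1\<close> is orthogonal to all
  products \<open>x\<^sub>i p\<^sub>n\<^sub>,\<^sub>k\<close>.  It is also orthogonal to everything of degree at most \<open>n\<close>.  Modulo
  such polynomials, a monomial of degree \<open>n + 1\<close> is \<open>x\<^sub>i\<close> times a linear combination of the
  \<open>p\<^sub>n\<^sub>,\<^sub>k\<close> (\<open>poly_leading_part\<close>).  So \<open>f\<close> is orthogonal to all polynomials of degree at most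
  \<open>n + 1\<close>, in particular to the \<open>p\<^sub>n\<^sub>+\<^sub>1\<^sub>,\<^sub>k\<close>, and these inner products are the
  coordinates of \<open>v\<close>.
\<close>

section \<open>Polynomial functions of bounded degree\<close>

lemma finite_multi_indices: "finite {\<alpha> :: 'd::finite \<Rightarrow> nat. (\<Sum>i\<in>UNIV. \<alpha> i) \<le> n}"
proof (rule finite_subset)
  show "{\<alpha> :: 'd \<Rightarrow> nat. (\<Sum>i\<in>UNIV. \<alpha> i) \<le> n} \<subseteq> (\<Pi>\<^sub>E i\<in>UNIV. {..n})"
  proof
    fix \<alpha> :: "'d \<Rightarrow> nat" assume a: "\<alpha> \<in> {\<alpha>. (\<Sum>i\<in>UNIV. \<alpha> i) \<le> n}"
    have "\<alpha> i \<le> n" for i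
      using member_le_sum[of i UNIV \<alpha>] a by simp
    then show "\<alpha> \<in> (\<Pi>\<^sub>E i\<in>UNIV. {..n})" by (simp add: PiE_UNIV_domain)
  qed
  show "finite (\<Pi>\<^sub>E i\<in>(UNIV :: 'd set). {..n})" by (intro finite_PiE) auto
qed

lemma monomial_in_polys_upto:
  assumes "(\<Sum>i\<in>UNIV. \<alpha> i) \<le> n"
  shows "monomial_fun \<alpha> \<in> polys_upto n"
proof -
  have "(\<Sum>\<beta> | (\<Sum>i\<in>UNIV. \<beta> i) \<le> n. (if \<beta> = \<alpha> then 1 else 0) * monomial_fun \<beta> x) = monomial_fun \<alpha> x" for x
    using assms by (simp add: finite_multi_indices if_distrib[of "\<lambda>z. z * _"] sum.delta cong: if_cong)
  then show ?thesis
    unfolding polys_upto_def by (auto intro!: exI[of _ "\<lambda>\<beta>. if \<beta> = \<alpha> then 1 else 0"])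
qed

lemma polys_upto_add:
  assumes "f \<in> polys_upto n" "g \<in> polys_upto n"
  shows "(\<lambda>x. f x + g x) \<in> polys_upto n"
proof -
  obtain a b where "f = (\<lambda>x. \<Sum>\<alpha> | (\<Sum>i\<in>UNIV. \<alpha> i) \<le> n. a \<alpha> * monomial_fun \<alpha> x)"
    and "g = (\<lambda>x. \<Sum>\<alpha> | (\<Sum>i\<in>UNIV. \<alpha> i) \<le> n. b \<alpha> * monomial_fun \<alpha> x)"
    using assms by (auto simp: polys_upto_def)
  then have "(\<lambda>x. f x + g x) = (\<lambda>x. \<Sum>\<alpha> | (\<Sum>i\<in>UNIV. \<alpha> i) \<le> n. (a \<alpha> + b \<alpha>) * monomial_fun \<alpha> x)"
    by (simp add: sum.distrib distrib_right)
  then show ?thesis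
    unfolding polys_upto_def by (intro CollectI exI[of _ "\<lambda>\<alpha>. a \<alpha> + b \<alpha>"])
qed

lemma polys_upto_scale:
  assumes "f \<in> polys_upto n"
  shows "(\<lambda>x. a * f x) \<in> polys_upto n"
proof -
  obtain c where "f = (\<lambda>x. \<Sum>\<alpha> | (\<Sum>i\<in>UNIV. \<alpha> i) \<le> n. c \<alpha> * monomial_fun \<alpha> x)"
    using assms by (auto simp: polys_upto_def)
  then have "(\<lambda>x. a * f x) = (\<lambda>x. \<Sum>\<alpha> | (\<Sum>i\<in>UNIV. \<alpha> i) \<le> n. (a * c \<alpha>) * monomial_fun \<alpha> x)"
    by (simp add: sum_distrib_left mult.assoc)
  then show ?thesis
    unfolding polys_upto_def by (intro CollectI exI[of _ "\<lambda>\<alpha>. a * c \<alpha>"])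
qed

lemma polys_upto_zero: "(\<lambda>x. 0) \<in> polys_upto n"
  using polys_upto_scale[OF monomial_in_polys_upto[of "\<lambda>_. 0"], of n 0] by simp

lemma polys_upto_sum:
  assumes "\<And>a. a \<in> I \<Longrightarrow> f a \<in> polys_upto n"
  shows "(\<lambda>x. \<Sum>a\<in>I. c a * f a x) \<in> polys_upto n"
  using assms
proof (induction I rule: infinite_finite_induct)
  case (insert b I)
  then show ?case
    using polys_upto_add[OF polys_upto_scale[of "f b" n "c b"]] by simp
qed (simp_all add: polys_upto_zero)

lemma polys_upto_mono:
  assumes "f \<in> polys_upto n" "n \<le> m"
  shows "f \<in> polys_upto m"
proof -
  obtain c where f: "f = (\<lambda>x. \<Sum>\<alpha> | (\<Sum>i\<in>UNIV. \<alpha> i) \<le> n. c \<alpha> * monomial_fun \<alpha> x)"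
    using assms by (auto simp: polys_upto_def)
  show ?thesis
    unfolding f using assms(2) by (intro polys_upto_sum monomial_in_polys_upto) auto
qed

lemma sum_fun_upd_Suc:
  fixes \<alpha> :: "'d::finite \<Rightarrow> nat"
  shows "(\<Sum>j\<in>UNIV. (\<alpha>(i := Suc (\<alpha> i))) j) = Suc (\<Sum>j\<in>UNIV. \<alpha> j)"
  by (simp add: sum.remove[of UNIV i])

lemma monomial_fun_upd_Suc:
  "monomial_fun (\<alpha>(i := Suc (\<alpha> i))) x = x $ i * monomial_fun \<alpha> x"
  unfolding monomial_fun_def by (simp add: prod.remove[of UNIV i])

lemma coordinate_mult_polys_upto:
  assumes "f \<in> polys_upto n"
  shows "(\<lambda>x. x $ i * f x) \<in> polys_upto (Suc n)"
proof -
  obtain c where f: "f = (\<lambda>x. \<Sum>\<alpha> | (\<Sum>i\<in>UNIV. \<alpha> i) \<le> n. c \<alpha> * monomial_fun \<alpha> x)"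
    using assms by (auto simp: polys_upto_def)
  have "(\<lambda>x. x $ i * f x) = (\<lambda>x. \<Sum>\<alpha> | (\<Sum>i\<in>UNIV. \<alpha> i) \<le> n. c \<alpha> * monomial_fun (\<alpha>(i := Suc (\<alpha> i))) x)"
    by (simp add: f monomial_fun_upd_Suc sum_distrib_left mult.left_commute)
  moreover have "\<dots> \<in> polys_upto (Suc n)"
    by (intro polys_upto_sum monomial_in_polys_upto, subst sum_fun_upd_Suc) simp
  ultimately show ?thesis by simp
qed

lemma monomial_degree_Suc_factor:
  fixes \<alpha> :: "'d::finite \<Rightarrow> nat"
  assumes "(\<Sum>i\<in>UNIV. \<alpha> i) = Suc n"
  obtains i \<beta> where "(\<Sum>j\<in>UNIV. \<beta> j) = n" "monomial_fun \<alpha> = (\<lambda>x. x $ i * monomial_fun \<beta> x)"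
proof -
  obtain i where "\<alpha> i \<noteq> 0"
    using assms by (metis nat.distinct(1) sum.neutral)
  then have a: "\<alpha> = (\<alpha>(i := \<alpha> i - 1))(i := Suc ((\<alpha>(i := \<alpha> i - 1)) i))" by auto
  have "(\<Sum>j\<in>UNIV. (\<alpha>(i := \<alpha> i - 1)) j) = n"
    using assms sum_fun_upd_Suc[of "\<alpha>(i := \<alpha> i - 1)" i] by (simp only: a[symmetric])
  moreover have "monomial_fun \<alpha> = (\<lambda>x. x $ i * monomial_fun (\<alpha>(i := \<alpha> i - 1)) x)"
    using a monomial_fun_upd_Suc[of "\<alpha>(i := \<alpha> i - 1)" i] by auto
  ultimately show thesis using that by blast
qed

section \<open>The inner product on polynomials\<close>

lemma polys_upto_measurable:
  assumes "f \<in> polys_upto n"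
  shows "f \<in> borel_measurable borel"
proof -
  have "continuous_on UNIV f"
    using assms unfolding polys_upto_def monomial_fun_def
    by (auto intro!: continuous_intros)
  then show ?thesis by (rule borel_measurable_continuous_onI)
qed

text \<open>
  Square integrability of each factor suffices, since \<open>|f g| \<le> f\<^sup>2 + g\<^sup>2\<close>.
\<close>

lemma integrable_poly_mult:
  assumes M: "admissible_measure M" and f: "f \<in> polys_upto m" and g: "g \<in> polys_upto n"
  shows "integrable M (\<lambda>x. f x * g x)"
proof -
  have sets: "sets M = sets borel" using M by (simp add: admissible_measure_def)
  have meas: "h \<in> borel_measurable M" if "h \<in> polys_upto k" for h k
    using polys_upto_measurable[OF that] sets measurable_cong_sets by blast
  have sq: "integrable M (\<lambda>x. (h x)\<^sup>2)" if h: "h \<in> polys_upto k" for h k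
  proof (rule integrableI_nonneg)
    show "(\<integral>\<^sup>+x. ennreal ((h x)\<^sup>2) \<partial>M) < \<infinity>"
    proof (cases "h = (\<lambda>x. 0)")
      case False
      then show ?thesis using M h by (auto simp: admissible_measure_def polys_def)
    qed simp
  qed (use meas[OF h] in auto)
  show ?thesis
  proof (rule Bochner_Integration.integrable_bound)
    show "integrable M (\<lambda>x. (f x)\<^sup>2 + (g x)\<^sup>2)"
      using sq[OF f] sq[OF g] by (rule Bochner_Integration.integrable_add)
    show "(\<lambda>x. f x * g x) \<in> borel_measurable M"
      using meas[OF f] meas[OF g] by (rule borel_measurable_times)
    have "\<bar>a * b\<bar> \<le> a\<^sup>2 + b\<^sup>2" for a b :: real
      using sum_squares_bound[of "\<bar>a\<bar>" "\<bar>b\<bar>"] mult_nonneg_nonneg[of "\<bar>a\<bar>" "\<bar>b\<bar>"]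
      by (simp only: abs_mult power2_abs) linarith
    then show "AE x in M. norm (f x * g x) \<le> norm ((f x)\<^sup>2 + (g x)\<^sup>2)"
      by simp
  qed
qed

lemma ip_commute: "ip M f g = ip M g f"
  by (simp add: ip_def mult.commute)

lemma ip_add_right:
  assumes "admissible_measure M" "f \<in> polys_upto m" "g \<in> polys_upto n" "h \<in> polys_upto k"
  shows "ip M f (\<lambda>x. g x + h x) = ip M f g + ip M f h"
  using integrable_poly_mult[OF assms(1,2,3)] integrable_poly_mult[OF assms(1,2,4)]
  by (simp add: ip_def distrib_left)

lemma ip_sum_right:
  assumes "admissible_measure M" "f \<in> polys_upto m" "\<And>a. a \<in> I \<Longrightarrow> g a \<in> polys_upto n"
  shows "ip M f (\<lambda>x. \<Sum>a\<in>I. c a * g a x) = (\<Sum>a\<in>I. c a * ip M f (g a))"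
proof -
  have "integrable M (\<lambda>x. c a * (f x * g a x))" if "a \<in> I" for a
    using integrable_poly_mult[OF assms(1,2) assms(3)[OF that]] by simp
  then show ?thesis
    by (simp add: ip_def sum_distrib_left mult.left_commute[of "f _"] Bochner_Integration.integral_sum)
qed

section \<open>Expansion in an orthonormal basis\<close>

lemma orthonormal_poly_basisD:
  fixes p :: "nat \<Rightarrow> real^'d \<Rightarrow> real Matrix.vec"
  assumes "orthonormal_poly_basis M p"
  shows "p n x \<in> carrier_vec (hom_dim TYPE('d) n)"
    and "k < hom_dim TYPE('d) n \<Longrightarrow> (\<lambda>x. p n x $v k) \<in> polys_upto n"
    and "k < hom_dim TYPE('d) n \<Longrightarrow> m < n \<Longrightarrow> q \<in> polys_upto m \<Longrightarrow> ip M (\<lambda>x. p n x $v k) q = 0"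
    and "j < hom_dim TYPE('d) n \<Longrightarrow> k < hom_dim TYPE('d) n \<Longrightarrow>
      ip M (\<lambda>x. p n x $v j) (\<lambda>x. p n x $v k) = (if j = k then 1 else 0)"
    and "q \<in> orth_polys M n \<Longrightarrow> \<exists>c. q = (\<lambda>x. \<Sum>k<hom_dim TYPE('d) n. c k * p n x $v k)"
proof -
  show "ip M (\<lambda>x. p n x $v k) q = 0"
    if "k < hom_dim TYPE('d) n" "m < n" "q \<in> polys_upto m"
  proof -
    have "(\<lambda>x. p n x $v k) \<in> orth_polys M n"
      using assms that(1) by (simp add: orthonormal_poly_basis_def Let_def)
    moreover have "q \<in> polys_upto (n - 1)"
      using polys_upto_mono[OF that(3), of "n - 1"] that(2) by simp
    ultimately show ?thesis using that(2) by (simp add: orth_polys_def)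
  qed
qed (use assms in \<open>auto simp: orthonormal_poly_basis_def orth_polys_def Let_def\<close>)

lemma orthonormal_across_degrees:
  fixes p :: "nat \<Rightarrow> real^'d \<Rightarrow> real Matrix.vec"
  assumes p: "orthonormal_poly_basis M p"
    and k: "k < hom_dim TYPE('d) n" and l: "l < hom_dim TYPE('d) m"
  shows "ip M (\<lambda>x. p n x $v k) (\<lambda>x. p m x $v l) = (if (n, k) = (m, l) then 1 else 0)"
proof (cases m n rule: linorder_cases)
  case less
  then show ?thesis using orthonormal_poly_basisD(3)[OF p k less orthonormal_poly_basisD(2)[OF p l]] by simp
next
  case equal
  then show ?thesis using orthonormal_poly_basisD(4)[OF p] k l by simp
next
  case greater
  then show ?thesis
    using orthonormal_poly_basisD(3)[OF p l greater orthonormal_poly_basisD(2)[OF p k]]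
    by (simp add: ip_commute)
qed

lemma sum_Sigma_atMost:
  fixes g :: "nat \<times> nat \<Rightarrow> real"
  shows "(\<Sum>a\<in>(SIGMA m:{..n}. {..<r m}). g a) = (\<Sum>a\<in>(SIGMA m:{..<n}. {..<r m}). g a) + (\<Sum>k<r n. g (n, k))"
proof -
  have "(\<Sum>a\<in>(SIGMA m:S. {..<r m}). g a) = (\<Sum>m\<in>S. \<Sum>k<r m. g (m, k))" if "finite S" for S
    using sum.Sigma[of S "\<lambda>m. {..<r m}" "\<lambda>m k. g (m, k)"] that by simp
  then show ?thesis by (simp add: lessThan_Suc_atMost[symmetric])
qed

text \<open>
  Subtracting from \<open>q\<close> its Fourier expansion \<open>\<Sum> \<langle>q, P\<^sub>a\<rangle> P\<^sub>a\<close> over the basis elements of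
  degree below \<open>n\<close> leaves a remainder orthogonal to these elements, hence, by induction, to all
  polynomials of degree below \<open>n\<close>.  So the remainder lies in the space that is spanned by the
  entries of \<open>p n\<close>.
\<close>

lemma poly_basis_spans:
  fixes p :: "nat \<Rightarrow> real^'d \<Rightarrow> real Matrix.vec"
  assumes M: "admissible_measure M" and p: "orthonormal_poly_basis M p"
    and "q \<in> polys_upto n"
  shows "\<exists>c. q = (\<lambda>x. \<Sum>a\<in>(SIGMA m:{..n}. {..<hom_dim TYPE('d) m}). c a * p (fst a) x $v snd a)"
  using assms(3)
proof (induction n arbitrary: q rule: less_induct)
  case (less n)
  let ?r = "hom_dim TYPE('d)"
  define I where "I = (SIGMA m:{..<n}. {..<?r m})"
  define P where "P = (\<lambda>a x. p (fst a) x $v snd a)"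
  define e where "e = (\<lambda>x. q x + (\<Sum>a\<in>I. (- ip M q (P a)) * P a x))"
  have P: "P a \<in> polys_upto n" if "a \<in> I" for a
    using that polys_upto_mono[OF orthonormal_poly_basisD(2)[OF p], of "snd a" "fst a" n]
    by (auto simp: I_def P_def)
  have fin: "finite I" by (simp add: I_def)
  have e: "e \<in> polys_upto n"
    unfolding e_def using less.prems P by (intro polys_upto_add polys_upto_sum)
  have eP: "ip M (P b) e = 0" if b: "b \<in> I" for b
  proof -
    have "ip M (P b) e = ip M (P b) q + ip M (P b) (\<lambda>x. \<Sum>a\<in>I. (- ip M q (P a)) * P a x)"
      unfolding e_def by (rule ip_add_right[OF M P[OF b] less.prems polys_upto_sum[OF P]])
    also have "ip M (P b) (\<lambda>x. \<Sum>a\<in>I. (- ip M q (P a)) * P a x)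
        = (\<Sum>a\<in>I. (- ip M q (P a)) * ip M (P b) (P a))"
      by (rule ip_sum_right[OF M P[OF b] P])
    also have "(\<Sum>a\<in>I. (- ip M q (P a)) * ip M (P b) (P a)) = (\<Sum>a\<in>I. if a = b then - ip M q (P a) else 0)"
    proof (intro sum.cong refl)
      fix a assume "a \<in> I"
      then have "ip M (P b) (P a) = (if a = b then 1 else 0)"
        using b orthonormal_across_degrees[OF p, of "snd b" "fst b" "snd a" "fst a"]
        by (auto simp: I_def P_def split: if_splits)
      then show "(- ip M q (P a)) * ip M (P b) (P a) = (if a = b then - ip M q (P a) else 0)" by simp
    qed
    finally show ?thesis using fin b by (simp add: ip_commute)
  qed
  have "e \<in> orth_polys M n"
    unfolding orth_polys_def
  proof (intro CollectI conjI e impI ballI)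
    fix f :: "real^'d \<Rightarrow> real" assume "0 < n" and f: "f \<in> polys_upto (n - 1)"
    then obtain c where c: "f = (\<lambda>x. \<Sum>a\<in>(SIGMA m:{..n - 1}. {..<?r m}). c a * p (fst a) x $v snd a)"
      using less.IH[of "n - 1"] by auto
    have "{..n - 1} = {..<n}" using \<open>0 < n\<close> by auto
    then have "f = (\<lambda>x. \<Sum>a\<in>I. c a * P a x)"
      by (simp add: c I_def P_def)
    then have "ip M e f = (\<Sum>a\<in>I. c a * ip M e (P a))"
      by (simp only:) (rule ip_sum_right[OF M e P])
    then show "ip M e f = 0"
      using eP by (simp add: ip_commute[of M e])
  qed
  then obtain c where c: "e = (\<lambda>x. \<Sum>k<?r n. c k * p n x $v k)"
    using orthonormal_poly_basisD(5)[OF p] by blast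
  define d where "d = (\<lambda>a. if fst a = n then c (snd a) else ip M q (P a))"
  have "q x = (\<Sum>a\<in>(SIGMA m:{..n}. {..<?r m}). d a * p (fst a) x $v snd a)" for x
  proof -
    have "(\<Sum>a\<in>(SIGMA m:{..n}. {..<?r m}). d a * p (fst a) x $v snd a)
        = (\<Sum>a\<in>I. d a * P a x) + (\<Sum>k<?r n. c k * p n x $v k)"
      by (simp add: sum_Sigma_atMost I_def P_def d_def)
    also have "(\<Sum>a\<in>I. d a * P a x) = (\<Sum>a\<in>I. ip M q (P a) * P a x)"
      by (intro sum.cong) (auto simp: I_def d_def)
    also have "(\<Sum>k<?r n. c k * p n x $v k) = e x"
      by (simp add: c)
    finally show ?thesis by (simp add: e_def sum_negf)
  qed
  then show ?case by blast
qed

text \<open>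
  The remainder \<open>e\<close> has degree below \<open>n\<close>.  Saying this through the products \<open>x\<^sub>i e\<close>, which is how it
  is used, also covers \<open>n = 0\<close>, where \<open>e\<close> vanishes.
\<close>

lemma poly_leading_part:
  fixes p :: "nat \<Rightarrow> real^'d \<Rightarrow> real Matrix.vec"
  assumes "admissible_measure M" and p: "orthonormal_poly_basis M p" and "q \<in> polys_upto n"
  obtains c e where "q = (\<lambda>x. (\<Sum>k<hom_dim TYPE('d) n. c k * p n x $v k) + e x)"
    and "\<And>i. (\<lambda>x. x $ i * e x) \<in> polys_upto n"
proof -
  let ?r = "hom_dim TYPE('d)"
  obtain c where c: "q = (\<lambda>x. \<Sum>a\<in>(SIGMA m:{..n}. {..<?r m}). c a * p (fst a) x $v snd a)"
    using poly_basis_spans[OF assms] by blast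
  define e where "e = (\<lambda>x. \<Sum>a\<in>(SIGMA m:{..<n}. {..<?r m}). c a * p (fst a) x $v snd a)"
  show thesis
  proof
    show "q = (\<lambda>x. (\<Sum>k<?r n. c (n, k) * p n x $v k) + e x)"
      by (simp add: c e_def sum_Sigma_atMost add.commute)
    fix i
    have "(\<lambda>x. x $ i * p (fst a) x $v snd a) \<in> polys_upto n"
      if "a \<in> (SIGMA m:{..<n}. {..<?r m})" for a
      using that polys_upto_mono[OF coordinate_mult_polys_upto[OF orthonormal_poly_basisD(2)[OF p]], of "snd a" "fst a" n]
      by auto
    then have "(\<lambda>x. \<Sum>a\<in>(SIGMA m:{..<n}. {..<?r m}). c a * (x $ i * p (fst a) x $v snd a)) \<in> polys_upto n"
      by (rule polys_upto_sum)
    then show "(\<lambda>x. x $ i * e x) \<in> polys_upto n"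
      by (simp add: e_def sum_distrib_left mult.left_commute)
  qed
qed

text \<open>
  By the recurrence, row \<open>k\<close> of \<open>x\<^sub>i p\<^sub>n\<close> is row \<open>k\<close> of \<open>B\<^sub>i p\<^sub>n\<^sub>+\<^sub>1\<close> plus a polynomial \<open>g\<close> of degree
  at most \<open>n\<close>.  Taking the inner product with an entry of \<open>p\<^sub>n\<^sub>+\<^sub>1\<close> kills \<open>g\<close> and
  extracts a single coefficient.
\<close>

lemma recurrence_inner_product:
  fixes p :: "nat \<Rightarrow> real^'d \<Rightarrow> real Matrix.vec"
  assumes M: "admissible_measure M" and p: "orthonormal_poly_basis M p"
    and rec: "recurrence_matrices p A B"
    and k: "k < hom_dim TYPE('d) n" and l: "l < hom_dim TYPE('d) (Suc n)"
  shows "ip M (\<lambda>x. p (Suc n) x $v l) (\<lambda>x. x $ i * p n x $v k) = B (Suc n) i $$ (k, l)"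
proof -
  let ?r = "hom_dim TYPE('d)"
  have A: "A (Suc n) i \<in> carrier_mat (?r n) (?r n)" and B: "B (Suc n) i \<in> carrier_mat (?r n) (?r (Suc n))"
    using rec by (simp_all add: recurrence_matrices_def Let_def)
  have Bn: "n \<noteq> 0 \<Longrightarrow> B n i \<in> carrier_mat (?r (n - 1)) (?r n)"
    using rec by (cases n) (simp_all add: recurrence_matrices_def Let_def)
  note pc = orthonormal_poly_basisD(1)[OF p]
  define g where "g = (\<lambda>x. (\<Sum>j<?r n. A (Suc n) i $$ (k, j) * p n x $v j) +
     (\<Sum>j\<in>(if n = 0 then {} else {..<?r (n - 1)}). B n i $$ (j, k) * p (n - 1) x $v j))"
  have g: "g \<in> polys_upto n"
    unfolding g_def
    by (intro polys_upto_add polys_upto_sum)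
       (auto split: if_splits intro: orthonormal_poly_basisD(2)[OF p] polys_upto_mono[OF orthonormal_poly_basisD(2)[OF p]])
  have "x $ i * p n x $v k = (\<Sum>j<?r (Suc n). B (Suc n) i $$ (k, j) * p (Suc n) x $v j) + g x" for x
  proof -
    have "(x $ i) \<cdot>\<^sub>v p n x =
           B (Suc n) i *\<^sub>v p (Suc n) x + A (Suc n) i *\<^sub>v p n x +
           (if n = 0 then 0\<^sub>v (?r n) else transpose_mat (B n i) *\<^sub>v p (n - 1) x)"
      using rec by (simp add: recurrence_matrices_def Let_def)
    then have "((x $ i) \<cdot>\<^sub>v p n x) $v k = (B (Suc n) i *\<^sub>v p (Suc n) x + A (Suc n) i *\<^sub>v p n x +
           (if n = 0 then 0\<^sub>v (?r n) else transpose_mat (B n i) *\<^sub>v p (n - 1) x)) $v k"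
      by simp
    then show ?thesis
      using k A B Bn pc[of n x] pc[of "Suc n" x] pc[of "n - 1" x]
      by (auto simp: g_def scalar_prod_def lessThan_atLeast0 split: if_splits)
  qed
  moreover have pl: "(\<lambda>x. p (Suc n) x $v j) \<in> polys_upto (Suc n)" if "j < ?r (Suc n)" for j
    using orthonormal_poly_basisD(2)[OF p that] .
  ultimately have "ip M (\<lambda>x. p (Suc n) x $v l) (\<lambda>x. x $ i * p n x $v k)
     = (\<Sum>j<?r (Suc n). B (Suc n) i $$ (k, j) * ip M (\<lambda>x. p (Suc n) x $v l) (\<lambda>x. p (Suc n) x $v j))
       + ip M (\<lambda>x. p (Suc n) x $v l) g"
    using ip_add_right[OF M pl[OF l] polys_upto_sum g, of "{..<?r (Suc n)}" "\<lambda>j x. p (Suc n) x $v j" "Suc n" "\<lambda>j. B (Suc n) i $$ (k, j)"]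
      ip_sum_right[OF M pl[OF l], of "{..<?r (Suc n)}" "\<lambda>j x. p (Suc n) x $v j" "Suc n" "\<lambda>j. B (Suc n) i $$ (k, j)"]
    by simp
  moreover have "ip M (\<lambda>x. p (Suc n) x $v l) g = 0"
    using orthonormal_poly_basisD(3)[OF p l _ g] by simp
  moreover have "(\<Sum>j<?r (Suc n). B (Suc n) i $$ (k, j) * ip M (\<lambda>x. p (Suc n) x $v l) (\<lambda>x. p (Suc n) x $v j))
     = (\<Sum>j<?r (Suc n). if j = l then B (Suc n) i $$ (k, j) else 0)"
    using orthonormal_poly_basisD(4)[OF p l] by (intro sum.cong) auto
  ultimately show ?thesis using l by simp
qed

text \<open>
  The matrix formed by stacking the \<open>B\<^sub>i\<close> has full column rank.  A kernel vector \<open>v\<close> yields a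
  polynomial \<open>f\<close> that is orthogonal to every monomial of degree at most \<open>n + 1\<close>: to those of lower degree
  because \<open>f\<close> is a combination of entries of \<open>p\<^sub>n\<^sub>+\<^sub>1\<close>, and to those of degree \<open>n + 1\<close> because they
  arise from degree \<open>n\<close> by multiplication with a coordinate.
\<close>

lemma stacked_recurrence_kernel_trivial:
  fixes p :: "nat \<Rightarrow> real^'d \<Rightarrow> real Matrix.vec"
  assumes M: "admissible_measure M" and p: "orthonormal_poly_basis M p"
    and rec: "recurrence_matrices p A B"
    and v: "v \<in> carrier_vec (hom_dim TYPE('d) (Suc n))"
    and ker: "\<And>i. B (Suc n) i *\<^sub>v v = 0\<^sub>v (hom_dim TYPE('d) n)"
  shows "v = 0\<^sub>v (hom_dim TYPE('d) (Suc n))"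
proof -
  let ?r = "hom_dim TYPE('d)"
  define f where "f = (\<lambda>x. \<Sum>l<?r (Suc n). v $v l * p (Suc n) x $v l)"
  have pl: "(\<lambda>x. p (Suc n) x $v l) \<in> polys_upto (Suc n)" if "l < ?r (Suc n)" for l
    using orthonormal_poly_basisD(2)[OF p that] .
  have f: "f \<in> polys_upto (Suc n)"
    unfolding f_def using pl by (intro polys_upto_sum) auto
  have ip_f: "ip M f q = (\<Sum>l<?r (Suc n). v $v l * ip M (\<lambda>x. p (Suc n) x $v l) q)"
    if "q \<in> polys_upto m" for q m
    using ip_sum_right[OF M that, of "{..<?r (Suc n)}" "\<lambda>l x. p (Suc n) x $v l" "Suc n" "\<lambda>l. v $v l"] pl
    by (simp add: f_def ip_commute[of M _ q])
  have low: "ip M f q = 0" if "q \<in> polys_upto n" for q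
    using ip_f[OF that] orthonormal_poly_basisD(3)[OF p _ _ that] by simp
  have xp: "ip M f (\<lambda>x. x $ i * p n x $v k) = 0" if k: "k < ?r n" for i k
  proof -
    have B: "B (Suc n) i \<in> carrier_mat (?r n) (?r (Suc n))"
      using rec by (simp add: recurrence_matrices_def Let_def)
    have "ip M f (\<lambda>x. x $ i * p n x $v k) = (\<Sum>l<?r (Suc n). v $v l * B (Suc n) i $$ (k, l))"
      using ip_f[OF coordinate_mult_polys_upto[OF orthonormal_poly_basisD(2)[OF p k]]]
        recurrence_inner_product[OF M p rec k] by simp
    also have "\<dots> = (B (Suc n) i *\<^sub>v v) $v k"
      using k B v by (simp add: scalar_prod_def lessThan_atLeast0 mult.commute)
    finally show ?thesis using ker k by simp
  qed
  have mon: "ip M f (monomial_fun \<alpha>) = 0" if "(\<Sum>i\<in>UNIV. \<alpha> i) \<le> Suc n" for \<alpha>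
  proof (cases "(\<Sum>i\<in>UNIV. \<alpha> i) = Suc n")
    case False
    then show ?thesis using that by (intro low monomial_in_polys_upto) simp
  next
    case True
    then obtain i \<beta> where "(\<Sum>j\<in>UNIV. \<beta> j) = n" and mf: "monomial_fun \<alpha> = (\<lambda>x. x $ i * monomial_fun \<beta> x)"
      by (rule monomial_degree_Suc_factor)
    then have "monomial_fun \<beta> \<in> polys_upto n" by (simp add: monomial_in_polys_upto)
    then obtain c e where ce: "monomial_fun \<beta> = (\<lambda>x. (\<Sum>k<?r n. c k * p n x $v k) + e x)"
      and e: "(\<lambda>x. x $ i * e x) \<in> polys_upto n"
      using poly_leading_part[OF M p] by metis
    have xpk: "(\<lambda>x. x $ i * p n x $v k) \<in> polys_upto (Suc n)" if "k \<in> {..<?r n}" for k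
      using coordinate_mult_polys_upto[OF orthonormal_poly_basisD(2)[OF p]] that by simp
    have "monomial_fun \<alpha> = (\<lambda>x. (\<Sum>k<?r n. c k * (x $ i * p n x $v k)) + x $ i * e x)"
      by (simp add: mf ce distrib_left sum_distrib_left mult.left_commute)
    then have "ip M f (monomial_fun \<alpha>)
        = ip M f (\<lambda>x. \<Sum>k<?r n. c k * (x $ i * p n x $v k)) + ip M f (\<lambda>x. x $ i * e x)"
      by (simp only:) (rule ip_add_right[OF M f polys_upto_sum[OF xpk] e])
    also have "\<dots> = 0"
      using ip_sum_right[OF M f xpk, of "{..<?r n}" "\<lambda>k. k" c] low[OF e] xp by simp
    finally show ?thesis .
  qed
  have "ip M f q = 0" if "q \<in> polys_upto (Suc n)" for q
  proof -
    obtain c where "q = (\<lambda>x. \<Sum>\<alpha> | (\<Sum>i\<in>UNIV. \<alpha> i) \<le> Suc n. c \<alpha> * monomial_fun \<alpha> x)"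
      using \<open>q \<in> polys_upto (Suc n)\<close> by (auto simp: polys_upto_def)
    then show ?thesis
      using ip_sum_right[OF M f monomial_in_polys_upto, of "{\<alpha>. (\<Sum>i\<in>UNIV. \<alpha> i) \<le> Suc n}" "\<lambda>\<alpha>. \<alpha>" "Suc n" c] mon
      by simp
  qed
  then have "ip M f (\<lambda>x. p (Suc n) x $v k) = 0" if "k < ?r (Suc n)" for k
    using pl that by blast
  moreover have "ip M f (\<lambda>x. p (Suc n) x $v k) = v $v k" if k: "k < ?r (Suc n)" for k
  proof -
    have "ip M f (\<lambda>x. p (Suc n) x $v k) = (\<Sum>l<?r (Suc n). if l = k then v $v l else 0)"
      unfolding ip_f[OF pl[OF k]] using orthonormal_poly_basisD(4)[OF p _ k] by (intro sum.cong) auto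
    then show ?thesis using k by simp
  qed
  ultimately show ?thesis using v by (intro eq_vecI) auto
qed

section \<open>Sums of matrices\<close>

lemma mat_sum_carrier: "mat_sum nr nc F \<in> carrier_mat nr nc"
  by (simp add: mat_sum_def)

lemma mat_sum_mult_vec_index:
  assumes "\<And>i. F i \<in> carrier_mat nr nc" and "v \<in> carrier_vec nc" and "j < nr"
  shows "(mat_sum nr nc F *\<^sub>v v) $v j = (\<Sum>i\<in>UNIV. (F i *\<^sub>v v) $v j)"
proof -
  have "(mat_sum nr nc F *\<^sub>v v) $v j = (\<Sum>k<nc. \<Sum>i\<in>UNIV. F i $$ (j, k) * v $v k)"
    using assms by (simp add: mat_sum_def scalar_prod_def sum_distrib_right lessThan_atLeast0)
  also have "\<dots> = (\<Sum>i\<in>UNIV. \<Sum>k<nc. F i $$ (j, k) * v $v k)"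
    by (rule sum.swap)
  also have "\<dots> = (\<Sum>i\<in>UNIV. (F i *\<^sub>v v) $v j)"
    using assms carrier_matD[OF assms(1)] by (simp add: scalar_prod_def lessThan_atLeast0)
  finally show ?thesis .
qed

lemma quadratic_form_gram_sum:
  fixes B :: "'d::finite \<Rightarrow> real Matrix.mat"
  assumes B: "\<And>i. B i \<in> carrier_mat m n" and v: "v \<in> carrier_vec n"
  shows "v \<bullet>v (mat_sum n n (\<lambda>i. transpose_mat (B i) * B i) *\<^sub>v v) = (\<Sum>i\<in>UNIV. (B i *\<^sub>v v) \<bullet>v (B i *\<^sub>v v))"
proof -
  have "v \<bullet>v (mat_sum n n (\<lambda>i. transpose_mat (B i) * B i) *\<^sub>v v)
      = (\<Sum>j<n. \<Sum>i\<in>UNIV. v $v j * ((transpose_mat (B i) * B i) *\<^sub>v v) $v j)"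
  proof -
    have BB: "transpose_mat (B i) * B i \<in> carrier_mat n n" for i
      using B by (meson mult_carrier_mat transpose_carrier_mat)
    have dim: "dim_vec (mat_sum n n (\<lambda>i. transpose_mat (B i) * B i) *\<^sub>v v) = n"
      by (simp add: mat_sum_def)
    show ?thesis
      unfolding scalar_prod_def dim
      using mat_sum_mult_vec_index[of "\<lambda>i. transpose_mat (B i) * B i", OF BB v]
      by (simp add: sum_distrib_left lessThan_atLeast0 del: index_mult_mat_vec)
  qed
  also have "\<dots> = (\<Sum>i\<in>UNIV. \<Sum>j<n. v $v j * ((transpose_mat (B i) * B i) *\<^sub>v v) $v j)"
    by (rule sum.swap)
  also have "\<dots> = (\<Sum>i\<in>UNIV. v \<bullet>v ((transpose_mat (B i) * B i) *\<^sub>v v))"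
    using B carrier_matD[OF B] by (simp add: scalar_prod_def lessThan_atLeast0)
  also have "\<dots> = (\<Sum>i\<in>UNIV. (B i *\<^sub>v v) \<bullet>v (B i *\<^sub>v v))"
  proof (intro sum.cong refl)
    fix i
    have "v \<bullet>v ((transpose_mat (B i) * B i) *\<^sub>v v) = v \<bullet>v (transpose_mat (B i) *\<^sub>v (B i *\<^sub>v v))"
      using B v by (metis assoc_mult_mat_vec transpose_carrier_mat)
    also have "\<dots> = (B i *\<^sub>v v) \<bullet>v (B i *\<^sub>v v)"
      using transpose_vec_mult_scalar[OF B v, of "B i *\<^sub>v v" i] B[of i] v
      by (metis comm_scalar_prod mult_mat_vec_carrier transpose_carrier_mat)
    finally show "v \<bullet>v ((transpose_mat (B i) * B i) *\<^sub>v v) = (B i *\<^sub>v v) \<bullet>v (B i *\<^sub>v v)" .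
  qed
  finally show ?thesis .
qed

lemma pos_def_diagonal_invertible:
  assumes pd: "pos_def_mat n L" and diag: "diagonal_mat L"
  shows "invertible_mat L"
proof -
  have L: "L \<in> carrier_mat n n" using pd by (simp add: pos_def_mat_def)
  have nz: "L $$ (j, j) \<noteq> 0" if j: "j < n" for j
  proof -
    have "unit_vec n j \<noteq> (0\<^sub>v n :: real Matrix.vec)"
      using j by (metis index_unit_vec(2) index_zero_vec(1) zero_neq_one)
    then have "unit_vec n j \<bullet>v (L *\<^sub>v unit_vec n j) > 0"
      using pd by (simp add: pos_def_mat_def)
    then show ?thesis using j L by simp 
  qed
  define D where "D = Matrix.mat n n (\<lambda>(i, j). if i = j then 1 / L $$ (i, i) else 0)"
  have off: "L $$ (i, j) = 0" if "i < n" "j < n" "i \<noteq> j" for i j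
    using diag L that by (auto simp: diagonal_mat_def)
  have "L * D = 1\<^sub>m n"
    using L nz off
    by (intro eq_matI) (auto simp: D_def scalar_prod_def if_distrib[of "\<lambda>z. _ * z"] cong: if_cong)
  moreover have "D * L = 1\<^sub>m n"
    using L nz off
    by (intro eq_matI) (auto simp: D_def scalar_prod_def if_distrib[of "\<lambda>z. z * _"] cong: if_cong)
  ultimately show ?thesis
    using L unfolding invertible_mat_def inverts_mat_def by (intro conjI exI[of _ D]) (auto simp: D_def)
qed

section \<open>The recurrence for a canonical basis\<close>

theorem theorem3p2:
  fixes M :: "(real^'d) measure"
    and p :: "nat \<Rightarrow> real^'d \<Rightarrow> real Matrix.vec"
    and A B :: "nat \<Rightarrow> 'd \<Rightarrow> real Matrix.mat"
    and \<Lambda> :: "nat \<Rightarrow> real Matrix.mat"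
    and r :: "nat \<Rightarrow> nat"
  defines "r \<equiv> hom_dim TYPE('d)"
  assumes "admissible_measure M"
    and "orthonormal_poly_basis M p"
    and "recurrence_matrices p A B"
    and "canonical_recurrence B \<Lambda>"
  shows "\<forall>n.
    (\<forall>x. \<Lambda> (Suc n) *\<^sub>v p (Suc n) x =
       mat_sum (r (Suc n)) (r n) (\<lambda>i. (x $ i) \<cdot>\<^sub>m transpose_mat (B (Suc n) i)) *\<^sub>v p n x
       - mat_sum (r (Suc n)) (r n) (\<lambda>i. transpose_mat (B (Suc n) i) * A (Suc n) i) *\<^sub>v p n x
       - (if n = 0 then 0\<^sub>v (r (Suc n))
          else mat_sum (r (Suc n)) (r (n - 1))
                 (\<lambda>i. transpose_mat (B (Suc n) i) * transpose_mat (B n i)) *\<^sub>v p (n - 1) x)) \<and>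
    \<Lambda> (Suc n) \<in> carrier_mat (r (Suc n)) (r (Suc n)) \<and>
    diagonal_mat (\<Lambda> (Suc n)) \<and>
    pos_def_mat (r (Suc n)) (\<Lambda> (Suc n)) \<and>
    invertible_mat (\<Lambda> (Suc n))"
proof (intro allI)
  fix n
  let ?B = "B (Suc n)" and ?A = "A (Suc n)"
  have L: "\<Lambda> (Suc n) = mat_sum (r (Suc n)) (r (Suc n)) (\<lambda>i. transpose_mat (?B i) * ?B i)"
    and diag: "diagonal_mat (\<Lambda> (Suc n))"
    using assms(5) by (auto simp: canonical_recurrence_def Let_def r_def)
  have A: "?A i \<in> carrier_mat (r n) (r n)" and B: "?B i \<in> carrier_mat (r n) (r (Suc n))" for i
    using assms(4) by (simp_all add: recurrence_matrices_def Let_def r_def)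
  have Bn: "n \<noteq> 0 \<Longrightarrow> B n i \<in> carrier_mat (r (n - 1)) (r n)" for i
    using assms(4) by (cases n) (simp_all add: recurrence_matrices_def Let_def r_def)
  have pc: "p m x \<in> carrier_vec (r m)" for m x
    using orthonormal_poly_basisD(1)[OF assms(3)] by (simp add: r_def)
  have Lc: "\<Lambda> (Suc n) \<in> carrier_mat (r (Suc n)) (r (Suc n))"
    by (simp add: L mat_sum_carrier)
  have pd: "pos_def_mat (r (Suc n)) (\<Lambda> (Suc n))"
    unfolding pos_def_mat_def
  proof (intro conjI ballI impI Lc)
    show "transpose_mat (\<Lambda> (Suc n)) = \<Lambda> (Suc n)"
      using diag Lc by (intro eq_matI) (auto simp: diagonal_mat_def, metis)
    fix v :: "real Matrix.vec" assume v: "v \<in> carrier_vec (r (Suc n))" and "v \<noteq> 0\<^sub>v (r (Suc n))"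
    then obtain i where i: "?B i *\<^sub>v v \<noteq> 0\<^sub>v (r n)"
      using stacked_recurrence_kernel_trivial[OF assms(2-4), of v n] by (auto simp: r_def)
    have nonneg: "(?B i *\<^sub>v v) \<bullet>v (?B i *\<^sub>v v) \<ge> 0" for i
      by (simp add: scalar_prod_def sum_nonneg)
    obtain k where k: "k < r n" "(?B i *\<^sub>v v) $v k \<noteq> 0"
      using i B by (metis carrier_matD(1) dim_mult_mat_vec eq_vecI index_zero_vec)
    have "0 < (?B i *\<^sub>v v) $v k * (?B i *\<^sub>v v) $v k"
      using k(2) by (simp flip: power2_eq_square)
    also have "\<dots> \<le> (?B i *\<^sub>v v) \<bullet>v (?B i *\<^sub>v v)"
      using member_le_sum[of k "{0..<dim_vec (?B i *\<^sub>v v)}" "\<lambda>k. (?B i *\<^sub>v v) $v k * (?B i *\<^sub>v v) $v k"] k(1) carrier_matD[OF B]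
      unfolding scalar_prod_def by auto
    also have "\<dots> \<le> (\<Sum>i\<in>UNIV. (?B i *\<^sub>v v) \<bullet>v (?B i *\<^sub>v v))"
      using nonneg by (intro member_le_sum) auto
    also have "\<dots> = v \<bullet>v (\<Lambda> (Suc n) *\<^sub>v v)"
      using quadratic_form_gram_sum[of ?B, OF B v] by (simp add: L)
    finally show "v \<bullet>v (\<Lambda> (Suc n) *\<^sub>v v) > 0" .
  qed
  have "\<Lambda> (Suc n) *\<^sub>v p (Suc n) x =
       mat_sum (r (Suc n)) (r n) (\<lambda>i. (x $ i) \<cdot>\<^sub>m transpose_mat (?B i)) *\<^sub>v p n x
       - mat_sum (r (Suc n)) (r n) (\<lambda>i. transpose_mat (?B i) * ?A i) *\<^sub>v p n x
       - (if n = 0 then 0\<^sub>v (r (Suc n))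
          else mat_sum (r (Suc n)) (r (n - 1))
                 (\<lambda>i. transpose_mat (?B i) * transpose_mat (B n i)) *\<^sub>v p (n - 1) x)"
    (is "_ = ?X - ?Y - ?Z") for x
  proof (rule eq_vecI)
    have dZ: "dim_vec ?Z = r (Suc n)" by (simp add: mat_sum_def)
    then show "dim_vec (\<Lambda> (Suc n) *\<^sub>v p (Suc n) x) = dim_vec (?X - ?Y - ?Z)"
      using Lc by simp
    fix j assume "j < dim_vec (?X - ?Y - ?Z)"
    then have j: "j < r (Suc n)" using dZ by simp
    \<comment> \<open>The last term of the recurrence, so that the case \<open>n = 0\<close> is treated only once.\<close>
    define w where "w i = (if n = 0 then 0\<^sub>v (r n) else transpose_mat (B n i) *\<^sub>v p (n - 1) x)" for i
    have wc: "w i \<in> carrier_vec (r n)" for i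
      using Bn[of i] pc by (auto simp: w_def)
    have rec: "(x $ i) \<cdot>\<^sub>v p n x = ?B i *\<^sub>v p (Suc n) x + ?A i *\<^sub>v p n x + w i" for i
      using assms(4) by (simp add: recurrence_matrices_def Let_def r_def w_def)
    have BT: "transpose_mat (?B i) \<in> carrier_mat (r (Suc n)) (r n)" for i
      using B by simp
    have smult: "((x $ i) \<cdot>\<^sub>m transpose_mat (?B i) *\<^sub>v p n x) $v j
        = (transpose_mat (?B i) *\<^sub>v ((x $ i) \<cdot>\<^sub>v p n x)) $v j" for i
      using carrier_matD[OF B[of i]] pc[of n x] j
      by (simp add: scalar_prod_def sum_distrib_left mult.assoc mult.left_commute)
    have X: "?X $v j = (\<Sum>i\<in>UNIV. (transpose_mat (?B i) *\<^sub>v ((x $ i) \<cdot>\<^sub>v p n x)) $v j)"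
      using mat_sum_mult_vec_index[of "\<lambda>i. (x $ i) \<cdot>\<^sub>m transpose_mat (?B i)", OF _ pc j] BT
      by (simp only: smult smult_carrier_mat)
    have Y: "?Y $v j = (\<Sum>i\<in>UNIV. (transpose_mat (?B i) *\<^sub>v (?A i *\<^sub>v p n x)) $v j)"
      using mat_sum_mult_vec_index[of "\<lambda>i. transpose_mat (?B i) * ?A i", OF mult_carrier_mat[OF BT A] pc j]
      by (simp only: assoc_mult_mat_vec[OF BT A pc])
    have Z: "?Z $v j = (\<Sum>i\<in>UNIV. (transpose_mat (?B i) *\<^sub>v w i) $v j)"
    proof (cases "n = 0")
      case True
      then have "(transpose_mat (?B i) *\<^sub>v w i) $v j = 0" for i
        using carrier_matD[OF B[of i]] j by (simp add: w_def scalar_prod_def)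
      then show ?thesis using True j by simp
    next
      case False
      have BnT: "transpose_mat (B n i) \<in> carrier_mat (r n) (r (n - 1))" for i
        using Bn[OF False] by simp
      show ?thesis
        using mat_sum_mult_vec_index[of "\<lambda>i. transpose_mat (?B i) * transpose_mat (B n i)",
            OF mult_carrier_mat[OF BT BnT] pc j] False
        by (simp only: assoc_mult_mat_vec[OF BT BnT pc] w_def if_False)
    qed
    have W: "(\<Lambda> (Suc n) *\<^sub>v p (Suc n) x) $v j = (\<Sum>i\<in>UNIV. (transpose_mat (?B i) *\<^sub>v (?B i *\<^sub>v p (Suc n) x)) $v j)"
      using mat_sum_mult_vec_index[of "\<lambda>i. transpose_mat (?B i) * ?B i", OF mult_carrier_mat[OF BT B] pc j]
      by (simp only: L assoc_mult_mat_vec[OF BT B pc])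
    have split: "(transpose_mat (?B i) *\<^sub>v ((x $ i) \<cdot>\<^sub>v p n x)) $v j =
       (transpose_mat (?B i) *\<^sub>v (?B i *\<^sub>v p (Suc n) x)) $v j + (transpose_mat (?B i) *\<^sub>v (?A i *\<^sub>v p n x)) $v j
       + (transpose_mat (?B i) *\<^sub>v w i) $v j" for i
    proof -
      have b: "?B i *\<^sub>v p (Suc n) x \<in> carrier_vec (r n)" and a: "?A i *\<^sub>v p n x \<in> carrier_vec (r n)"
        using mult_mat_vec_carrier[OF B pc] mult_mat_vec_carrier[OF A pc] by auto
      show ?thesis
        unfolding rec mult_add_distrib_mat_vec[OF BT add_carrier_vec[OF b a] wc]
          mult_add_distrib_mat_vec[OF BT b a]
        using j carrier_matD[OF BT[of i]] by (simp del: index_mult_mat_vec)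
    qed
    have "?X $v j = (\<Lambda> (Suc n) *\<^sub>v p (Suc n) x) $v j + ?Y $v j + ?Z $v j"
      unfolding X Y Z W split by (simp only: sum.distrib)
    moreover have "(?X - ?Y - ?Z) $v j = ?X $v j - ?Y $v j - ?Z $v j"
      using j dZ by (simp add: mat_sum_def del: index_mult_mat_vec)
    ultimately show "(\<Lambda> (Suc n) *\<^sub>v p (Suc n) x) $v j = (?X - ?Y - ?Z) $v j"
      by linarith
  qed
  then show "(\<forall>x. \<Lambda> (Suc n) *\<^sub>v p (Suc n) x =
       mat_sum (r (Suc n)) (r n) (\<lambda>i. (x $ i) \<cdot>\<^sub>m transpose_mat (?B i)) *\<^sub>v p n x
       - mat_sum (r (Suc n)) (r n) (\<lambda>i. transpose_mat (?B i) * ?A i) *\<^sub>v p n x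
       - (if n = 0 then 0\<^sub>v (r (Suc n))
          else mat_sum (r (Suc n)) (r (n - 1))
                 (\<lambda>i. transpose_mat (?B i) * transpose_mat (B n i)) *\<^sub>v p (n - 1) x)) \<and>
    \<Lambda> (Suc n) \<in> carrier_mat (r (Suc n)) (r (Suc n)) \<and>
    diagonal_mat (\<Lambda> (Suc n)) \<and>
    pos_def_mat (r (Suc n)) (\<Lambda> (Suc n)) \<and>
    invertible_mat (\<Lambda> (Suc n))"
    using Lc diag pd pos_def_diagonal_invertible[OF pd diag] by blast
qed

end
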